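(* Let $q>0$, and let $x_0=x_0(q)$ be the unique positive zero of the $q$-digamma function $\psi_q$. Then the function $\Gamma_q$ is logarithmically completely monotonic on $(0,x_0)$. Consequently, the inequality $$\Gamma_{q}(x+1)\,\Gamma_{q}(y+1)\leq \Gamma_{q}(x+y+2)$$ holds for all $x,y\in(0,1)$.
   Context: For $x>0$ the $q$-gamma function is $$\Gamma_q(x)=(1-q)^{1-x}\prod_{j=0}^{\infty}\frac{1-q^{j+1}}{1-q^{j+x}}\quad (0<q<1),$$ $$\Gamma_q(x)=(q-1)^{1-x}q^{\frac{x(x-1)}{2}}\prod_{j=0}^{\infty}\frac{1-q^{-(j+1)}}{1-q^{-(j+x)}}\quad (q>1),$$ and for $q=1$ it is understood as the limit as $q\to 1$, i.e. $\Gamma_1=\Gamma$ (Euler's gamma function). The $q$-digamma function is $\psi_q(x)=\Gamma_q'(x)/\Gamma_q(x)$ for $x>0$. It is known that for each $q>0$ the function $\psi_q$ has a uniquely determined positive zero, denoted $x_0=x_0(q)$, and $x_0\in(1,2)$. A positive function $f$ is logarithmically completely monotonic on an interval $I$ if it has derivatives of all orders on $I$ and $(-1)^n\left(\ln f\right)^{(n)}(x)\geq 0$ for all $x\in I$ and all positive integers $n$. *)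

theory Defs
  imports "HOL-Analysis.Analysis"
begin

text \<open>
  The \<open>q\<close>-gamma function and \<open>q\<close>-digamma function are meaningful for \<open>q > 0\<close> and \<open>x > 0\<close> only;
  other arguments yield irrelevant values. In this range no factor of the products below vanishes.
  At \<open>q = 1\<close> the value is the limit of the other two branches as \<open>q\<close> tends to \<open>1\<close>, which is
  Euler's gamma function.
\<close>

definition q_Gamma :: "real \<Rightarrow> real \<Rightarrow> real" where
  "q_Gamma q x =
     (if q < 1 then
        (1 - q) powr (1 - x) *
        (\<Prod>j. (1 - q powr (real j + 1)) / (1 - q powr (real j + x)))
      else if q = 1 then Gamma x
      else
        (q - 1) powr (1 - x) * q powr (x * (x - 1) / 2) *
        (\<Prod>j. (1 - q powr (- (real j + 1))) / (1 - q powr (- (real j + x)))))"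

definition q_Digamma :: "real \<Rightarrow> real \<Rightarrow> real" where
  "q_Digamma q x = deriv (q_Gamma q) x / q_Gamma q x"

text \<open>For every \<open>q > 0\<close> there is exactly one such zero, and it lies between \<open>1\<close> and \<open>2\<close>.\<close>

definition q_Digamma_zero :: "real \<Rightarrow> real" where
  "q_Digamma_zero q = (THE x. 0 < x \<and> q_Digamma q x = 0)"

text \<open>
  Restricted to open intervals, where the two-sided derivative used by \<^const>\<open>deriv\<close> depends only
  on the values of the function on the interval. Since \<^const>\<open>deriv\<close> is total, the existence of
  all derivatives is a separate requirement.
\<close>

definition log_completely_monotonic_on :: "(real \<Rightarrow> real) \<Rightarrow> real set \<Rightarrow> bool" where
  "log_completely_monotonic_on f I \<longleftrightarrow>
     open I \<and> is_interval I \<and>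
     (\<forall>x\<in>I. 0 < f x) \<and>
     (\<forall>n. \<forall>x\<in>I. (deriv ^^ n) f field_differentiable at x) \<and>
     (\<forall>n\<ge>1. \<forall>x\<in>I. 0 \<le> (- 1) ^ n * (deriv ^^ n) (\<lambda>t. ln (f t)) x)"

end

theory Submission
  imports Defs
begin

text \<open>
  Write \<open>p = min q (1/q)\<close> when \<open>q \<noteq> 1\<close>. Both branches of the \<open>q\<close>-gamma function consist of the
  exponential of a polynomial in \<open>x\<close> of degree at most two and one and the same infinite product
  in the base \<open>p\<close>. The power series \<open>F u = (\<Sum>k\<ge>1. u^k / (k (1 - p^k)))\<close> satisfies
  \<open>F u - F (u p) = - ln (1 - u)\<close>, because the factor \<open>1 - p^k\<close> cancels and the logarithmic series
  remains. Hence the logarithm of the product telescopes, with sum \<open>F (p^x) - F p\<close>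
  (\<open>q_product_eq\<close>). Each differentiation of \<open>F (p^x)\<close> in \<open>x\<close> multiplies the \<open>k\<close>-th term by
  \<open>k ln p < 0\<close>, while all coefficients of \<open>F\<close> are positive. The polynomial has a nonnegative second
  derivative and none beyond it, so \<open>(-1)^n (ln f)^(n) > 0\<close> for every \<open>n \<ge> 2\<close>, where \<open>f\<close> is the
  \<open>q\<close>-gamma function. For \<open>q = 1\<close> the same signs are those of the polygamma functions.

  The rest uses only these signs and \<open>f 1 = f 2 = 1\<close>
  (\<open>monotonicity_and_product_bound_from_derivatives\<close>). Since \<open>ln f\<close> vanishes at \<open>1\<close> and at
  \<open>2\<close>, Rolle's theorem gives a zero of \<open>(ln f)'\<close> between them; since \<open>(ln f)'\<close> increases strictly,
  this is its only zero and \<open>(ln f)'\<close> is negative to the left of it, which is the missing case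
  \<open>n = 1\<close>. Convexity also gives \<open>f \<le> 1\<close> on \<open>[1,2]\<close> and \<open>f \<ge> 1\<close> on \<open>[2,\<infinity>)\<close>, so for
  \<open>x, y\<close> in \<open>(0,1)\<close> the number \<open>1\<close> separates \<open>f (x + 1) * f (y + 1)\<close> from \<open>f (x + y + 2)\<close>.
\<close>

section \<open>Existence of higher derivatives\<close>

text \<open>
  The derivatives are quantified existentially instead of being iterates of \<^const>\<open>deriv\<close>, so that
  closure properties follow by induction on the order, without any formula for the higher
  derivatives of a product or of a composition.
\<close>

primrec times_differentiable_on :: "nat \<Rightarrow> real set \<Rightarrow> (real \<Rightarrow> real) \<Rightarrow> bool" where
  "times_differentiable_on 0 I h \<longleftrightarrow> True"
| "times_differentiable_on (Suc n) I h \<longleftrightarrow>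
     (\<exists>h'. (\<forall>x\<in>I. (h has_real_derivative h' x) (at x)) \<and> times_differentiable_on n I h')"

lemma times_differentiable_on_SucD:
  "times_differentiable_on (Suc n) I h \<Longrightarrow> times_differentiable_on n I h"
  by (induction n arbitrary: h) (simp, metis times_differentiable_on.simps(2))

lemma times_differentiable_on_cong:
  assumes "open I" "\<And>x. x \<in> I \<Longrightarrow> h x = k x" "times_differentiable_on n I h"
  shows "times_differentiable_on n I k"
proof (cases n)
  case (Suc m)
  then obtain h' where h': "\<forall>x\<in>I. (h has_real_derivative h' x) (at x)"
    "times_differentiable_on m I h'"
    using assms(3) by auto
  have "(k has_real_derivative h' x) (at x)" if "x \<in> I" for x
    using has_field_derivative_transform_within_open[OF _ assms(1) that] h' that assms(2) by metis
  with h' Suc show ?thesis by auto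
qed simp

lemma times_differentiable_on_add:
  assumes "times_differentiable_on n I h" "times_differentiable_on n I k"
  shows "times_differentiable_on n I (\<lambda>x. h x + k x)"
  using assms
proof (induction n arbitrary: h k)
  case (Suc n)
  obtain h' k' where d: "\<forall>x\<in>I. (h has_real_derivative h' x) (at x)"
    "\<forall>x\<in>I. (k has_real_derivative k' x) (at x)"
    and "times_differentiable_on n I h'" "times_differentiable_on n I k'"
    using Suc.prems by auto
  then have "times_differentiable_on n I (\<lambda>x. h' x + k' x)"
    by (intro Suc.IH)
  moreover have "\<forall>x\<in>I. ((\<lambda>x. h x + k x) has_real_derivative (h' x + k' x)) (at x)"
    using d by (auto intro!: DERIV_add)
  ultimately show ?case
    unfolding times_differentiable_on.simps(2)
    by (intro exI[of _ "\<lambda>x. h' x + k' x"] conjI)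
qed simp

lemma times_differentiable_on_mult:
  assumes "times_differentiable_on n I h" "times_differentiable_on n I k"
  shows "times_differentiable_on n I (\<lambda>x. h x * k x)"
  using assms
proof (induction n arbitrary: h k)
  case (Suc n)
  obtain h' k' where d: "\<forall>x\<in>I. (h has_real_derivative h' x) (at x)"
    "\<forall>x\<in>I. (k has_real_derivative k' x) (at x)"
    and n: "times_differentiable_on n I h'" "times_differentiable_on n I k'"
    using Suc.prems by auto
  have "times_differentiable_on n I (\<lambda>x. h' x * k x + k' x * h x)"
    using Suc.prems[THEN times_differentiable_on_SucD]
    by (intro times_differentiable_on_add Suc.IH n)
  moreover have "\<forall>x\<in>I. ((\<lambda>x. h x * k x) has_real_derivative (h' x * k x + k' x * h x)) (at x)"
    using d by (auto intro!: DERIV_mult)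
  ultimately show ?case
    unfolding times_differentiable_on.simps(2)
    by (intro exI[of _ "\<lambda>x. h' x * k x + k' x * h x"] conjI)
qed simp

text \<open>
  The derivative of \<open>exp \<circ> g\<close> is \<open>exp \<circ> g\<close> times \<open>g'\<close>, and both factors need only one order of
  differentiability less. This replaces the formula of Faa di Bruno.
\<close>

lemma times_differentiable_on_exp:
  assumes "times_differentiable_on n I g"
  shows "times_differentiable_on n I (\<lambda>x. exp (g x))"
  using assms
proof (induction n)
  case (Suc n)
  obtain g' where g': "\<forall>x\<in>I. (g has_real_derivative g' x) (at x)" "times_differentiable_on n I g'"
    using Suc.prems by auto
  have "times_differentiable_on n I (\<lambda>x. exp (g x) * g' x)"
    using Suc.prems[THEN times_differentiable_on_SucD]
    by (intro times_differentiable_on_mult g' Suc.IH)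
  moreover have "\<forall>x\<in>I. ((\<lambda>x. exp (g x)) has_real_derivative exp (g x) * g' x) (at x)"
    using g'(1) by (auto intro!: DERIV_fun_exp)
  ultimately show ?case
    unfolding times_differentiable_on.simps(2)
    by (intro exI[of _ "\<lambda>x. exp (g x) * g' x"] conjI)
qed simp

lemma times_differentiable_on_derivative_sequence:
  assumes "\<And>n x. x \<in> I \<Longrightarrow> (D n has_real_derivative D (Suc n) x) (at x)"
  shows "times_differentiable_on n I (D m)"
  by (induction n arbitrary: m) (use assms in auto)

lemma times_differentiable_on_imp_higher_deriv_differentiable:
  assumes "open I" "x \<in> I" "times_differentiable_on (Suc n) I h"
  shows "(deriv ^^ n) h field_differentiable at x"
  using assms(3)
proof (induction n arbitrary: h)
  case 0
  then show ?case using assms(2) by (auto simp: field_differentiable_def)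
next
  case (Suc n)
  obtain h' where h': "\<forall>x\<in>I. (h has_real_derivative h' x) (at x)"
    "times_differentiable_on (Suc n) I h'"
    using Suc.prems by (auto simp del: times_differentiable_on.simps(2)
        simp: times_differentiable_on.simps(2)[of "Suc n"])
  have "times_differentiable_on (Suc n) I (deriv h)"
    using times_differentiable_on_cong[OF assms(1) _ h'(2), of "deriv h"] h'(1)
    by (metis DERIV_imp_deriv)
  then show ?case by (simp add: Suc.IH funpow_swap1)
qed

lemma higher_deriv_derivative_sequence:
  assumes "open I" "x \<in> I"
    and "\<And>x. x \<in> I \<Longrightarrow> h x = D 0 x"
    and "\<And>n x. x \<in> I \<Longrightarrow> (D n has_real_derivative D (Suc n) x) (at x)"
  shows "(deriv ^^ n) h x = D n x"
  using assms(2)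
proof (induction n arbitrary: x)
  case (Suc n)
  have "((deriv ^^ n) h has_real_derivative D (Suc n) x) (at x)"
    using has_field_derivative_transform_within_open[OF assms(4)[OF Suc.prems] assms(1) Suc.prems]
      Suc.IH by metis
  then show ?case by (simp add: DERIV_imp_deriv)
qed (simp add: assms(3))

section \<open>Log-convex functions taking the value one at one and two\<close>

text \<open>
  Strict positivity at \<open>n = 2\<close> makes the zero of the logarithmic derivative unique, so the
  definite description denotes the zero that Rolle's theorem provides. The product bound does not
  come from superadditivity: the two sides are separated by \<open>1\<close>.
\<close>

lemma monotonicity_and_product_bound_from_derivatives:
  fixes f :: "real \<Rightarrow> real" and D :: "nat \<Rightarrow> real \<Rightarrow> real"
  assumes pos: "\<And>x. 0 < x \<Longrightarrow> 0 < f x"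
    and ln_f: "\<And>x. 0 < x \<Longrightarrow> ln (f x) = D 0 x"
    and deriv_D: "\<And>n x. 0 < x \<Longrightarrow> (D n has_real_derivative D (Suc n) x) (at x)"
    and sign: "\<And>n x. 2 \<le> n \<Longrightarrow> 0 < x \<Longrightarrow> 0 < (- 1) ^ n * D n x"
    and one: "f 1 = 1" and two: "f 2 = 1"
  defines "x0 \<equiv> (THE x. 0 < x \<and> deriv f x / f x = 0)"
  shows "log_completely_monotonic_on f {0<..<x0}"
    and "\<And>x y. x \<in> {0<..<1} \<Longrightarrow> y \<in> {0<..<1} \<Longrightarrow> f (x + 1) * f (y + 1) \<le> f (x + y + 2)"
proof -
  have f_exp: "f x = exp (D 0 x)" if "0 < x" for x
    using pos ln_f that by (metis exp_ln)
  have "(f has_real_derivative f x * D 1 x) (at x)" if "0 < x" for x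
  proof (rule has_field_derivative_transform_within_open)
    show "((\<lambda>x. exp (D 0 x)) has_real_derivative f x * D 1 x) (at x)"
      using deriv_D[OF that, of 0] by (auto intro!: derivative_eq_intros simp: f_exp that)
  qed (use that f_exp in \<open>auto intro: open_greaterThan\<close>)
  then have log_deriv: "deriv f x / f x = D 1 x" if "0 < x" for x
    using pos[OF that] DERIV_imp_deriv that by fastforce
  have D1_mono: "D 1 x < D 1 y" if "0 < x" "x < y" for x y
  proof (rule DERIV_pos_imp_increasing[OF that(2)])
    fix t assume "x \<le> t" "t \<le> y"
    with that have "0 < t" by simp
    then show "\<exists>d. (D 1 has_real_derivative d) (at t) \<and> 0 < d"
      using sign[of 2 t] deriv_D[of t 1] by (auto simp: numeral_2_eq_2)
  qed
  have D0_12: "D 0 1 = 0" "D 0 2 = 0"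
    using ln_f[of 1] ln_f[of 2] one two by auto
  \<comment> \<open>Rolle's theorem on the interval between the two points where the logarithm vanishes\<close>
  have "\<exists>z. 1 < z \<and> z < 2 \<and> D 1 z = 0"
  proof -
    have cont: "continuous_on {1..2} (D 0)"
      by (intro continuous_at_imp_continuous_on ballI DERIV_isCont[OF deriv_D]) auto
    obtain z where "1 < z" "z < 2" "(\<lambda>v. D 1 z * v) = (\<lambda>v. 0)"
      using Rolle_deriv[of 1 2 "D 0" "\<lambda>x v. D 1 x * v"] cont D0_12 deriv_D[of _ 0]
      by (auto simp: has_field_derivative_def)
    then show ?thesis by (metis mult.right_neutral)
  qed
  then obtain z where z: "1 < z" "z < 2" "D 1 z = 0" by blast
  have x0: "x0 = z"
    unfolding x0_def
  proof (rule the_equality)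
    fix x assume "0 < x \<and> deriv f x / f x = 0"
    then show "x = z"
      using log_deriv[of x] D1_mono[of x z] D1_mono[of z x] z by (cases x z rule: linorder_cases) auto
  qed (use z log_deriv in auto)
  have D1_neg: "D 1 x < 0" if "0 < x" "x < z" for x
    using D1_mono[OF that] z by simp
  show "log_completely_monotonic_on f {0<..<x0}"
    unfolding log_completely_monotonic_on_def x0
  proof (intro conjI allI ballI impI)
    fix n x assume x: "x \<in> {0<..<z}"
    have "times_differentiable_on (Suc n) {0<..<z} (\<lambda>x. exp (D 0 x))"
      by (intro times_differentiable_on_exp times_differentiable_on_derivative_sequence)
        (use deriv_D in auto)
    then have "times_differentiable_on (Suc n) {0<..<z} f"
      by (rule times_differentiable_on_cong[rotated 2]) (auto simp: f_exp)
    then show "(deriv ^^ n) f field_differentiable at x"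
      using x by (intro times_differentiable_on_imp_higher_deriv_differentiable) auto
  next
    fix n :: nat and x assume n: "1 \<le> n" and x: "x \<in> {0<..<z}"
    have "(deriv ^^ n) (\<lambda>t. ln (f t)) x = D n x"
      by (rule higher_deriv_derivative_sequence[OF _ x]) (use ln_f deriv_D in auto)
    then show "0 \<le> (- 1) ^ n * (deriv ^^ n) (\<lambda>t. ln (f t)) x"
      using sign[of n x] D1_neg[of x] n x by (cases "n = 1") (auto intro: less_imp_le)
  qed (auto simp: pos is_interval_oo)
  have le_one: "f t \<le> 1" if "1 < t" "t < 2" for t
  proof -
    have "D 0 t \<le> 0"
    proof (cases "t \<le> z")
      case True
      have "D 0 t \<le> D 0 1"
      proof (rule DERIV_nonpos_imp_nonincreasing[where f = "D 0"])
        fix s assume s: "1 \<le> s" "s \<le> t"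
        then have "D 1 s \<le> 0"
          using D1_neg[of s] z True by (cases "s = z") auto
        then show "\<exists>d. (D 0 has_real_derivative d) (at s) \<and> d \<le> 0"
          using deriv_D[of s 0] s by auto
      qed (use that in auto)
      then show ?thesis using D0_12 by simp
    next
      case False
      have "D 0 t \<le> D 0 2"
      proof (rule DERIV_nonneg_imp_nondecreasing[where f = "D 0"])
        fix s assume s: "t \<le> s" "s \<le> 2"
        then show "\<exists>d. (D 0 has_real_derivative d) (at s) \<and> 0 \<le> d"
          using deriv_D[of s 0] s D1_mono[of z s] z False by fastforce
      qed (use that in auto)
      then show ?thesis using D0_12 by simp
    qed
    then show ?thesis using that by (simp add: f_exp)
  qed
  have one_le: "1 \<le> f t" if "2 \<le> t" for t
  proof -
    have "D 0 2 \<le> D 0 t"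
    proof (rule DERIV_nonneg_imp_nondecreasing[where f = "D 0"])
      fix s assume s: "2 \<le> s" "s \<le> t"
      then show "\<exists>d. (D 0 has_real_derivative d) (at s) \<and> 0 \<le> d"
        using deriv_D[of s 0] s D1_mono[of z s] z by fastforce
    qed (use that in auto)
    then show ?thesis using that D0_12 by (simp add: f_exp)
  qed
  fix x y :: real assume xy: "x \<in> {0<..<1}" "y \<in> {0<..<1}"
  have "f (x + 1) * f (y + 1) \<le> 1"
    using xy by (intro mult_le_one le_one less_imp_le[OF pos]) auto
  also have "\<dots> \<le> f (x + y + 2)"
    using xy by (intro one_le) auto
  finally show "f (x + 1) * f (y + 1) \<le> f (x + y + 2)" .
qed

section \<open>The logarithm of the infinite product\<close>

text \<open>
  Up to the factor \<open>(ln p)^m\<close>, this is the \<open>m\<close>-th derivative in \<open>x\<close> of the series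
  \<open>\<Sum>k. p^(k x) / (k (1 - p^k))\<close>, expressed in the variable \<open>u = p^x\<close>. The term \<open>k = 0\<close> vanishes,
  since its denominator is zero and a quotient by zero is zero.
\<close>

definition q_log_series :: "real \<Rightarrow> nat \<Rightarrow> real \<Rightarrow> real" where
  "q_log_series p m u = (\<Sum>k. real k ^ m / (real k * (1 - p ^ k)) * u ^ k)"

text \<open>
  Multiplying the coefficients by their index is the operator \<open>u d/du\<close>, which keeps the radius of
  convergence. After the substitution \<open>u = p^x\<close> it becomes \<open>d/dx\<close> up to the factor \<open>ln p\<close>.
\<close>

lemma summable_powser_index_mult:
  fixes c :: "nat \<Rightarrow> real"
  assumes "\<And>u. \<bar>u\<bar> < 1 \<Longrightarrow> summable (\<lambda>k. c k * u ^ k)" "\<bar>u\<bar> < 1"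
  shows "summable (\<lambda>k. real k * c k * u ^ k)"
    and "(\<Sum>k. real k * c k * u ^ k) = (\<Sum>k. diffs c k * u ^ k) * u"
proof -
  have s: "summable (\<lambda>k. diffs c k * u ^ k)"
    using assms by (intro termdiff_converges[where K = 1]) auto
  have eq: "(\<lambda>k. diffs c k * u ^ k * u) = (\<lambda>k. real (Suc k) * c (Suc k) * u ^ Suc k)"
    by (simp add: diffs_def mult_ac fun_eq_iff)
  have "summable (\<lambda>k. real (Suc k) * c (Suc k) * u ^ Suc k)"
    using summable_mult2[OF s, of u] unfolding eq .
  then show s': "summable (\<lambda>k. real k * c k * u ^ k)"
    by (subst (asm) summable_Suc_iff)
  show "(\<Sum>k. real k * c k * u ^ k) = (\<Sum>k. diffs c k * u ^ k) * u"
    using suminf_split_head[OF s'] suminf_mult2[OF s, of u] eq by simp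
qed

context
  fixes p :: real
  assumes p: "0 < p" "p < 1"
begin

lemma base_powr_less_one: "0 < x \<Longrightarrow> p powr x < 1"
  using p by (simp add: powr_def mult_pos_neg)

lemma summable_q_log_series:
  assumes "\<bar>u\<bar> < 1"
  shows "summable (\<lambda>k. real k ^ m / (real k * (1 - p ^ k)) * u ^ k)"
  using assms
proof (induction m arbitrary: u)
  case 0
  show ?case
  proof (rule summable_comparison_test')
    show "summable (\<lambda>k. 1 / (1 - p) * \<bar>u\<bar> ^ k)"
      using 0 by (intro summable_mult summable_geometric) auto
    fix k :: nat assume "1 \<le> k"
    then have "p ^ k \<le> p ^ 1" using p by (intro power_decreasing) auto
    then have "1 - p \<le> 1 - p ^ k" by simp
    also have "\<dots> \<le> real k * (1 - p ^ k)"
      using mult_right_mono[of 1 "real k" "1 - p ^ k"] \<open>1 \<le> k\<close> p \<open>p ^ k \<le> p ^ 1\<close> by auto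
    finally have "1 - p \<le> real k * (1 - p ^ k)" .
    then have "\<bar>1 / (real k * (1 - p ^ k))\<bar> \<le> 1 / (1 - p)"
      using p by (auto intro!: frac_le)
    then have "\<bar>1 / (real k * (1 - p ^ k))\<bar> * \<bar>u\<bar> ^ k \<le> 1 / (1 - p) * \<bar>u\<bar> ^ k"
      by (rule mult_right_mono) simp
    then show "norm (real k ^ 0 / (real k * (1 - p ^ k)) * u ^ k) \<le> 1 / (1 - p) * \<bar>u\<bar> ^ k"
      by (simp add: abs_mult power_abs)
  qed
next
  case (Suc m)
  show ?case
    using summable_powser_index_mult(1)[OF Suc.IH Suc.prems] by (simp add: mult.assoc)
qed

lemma DERIV_q_log_series:
  assumes "\<bar>u\<bar> < 1"
  shows "\<exists>d. (q_log_series p m has_real_derivative d) (at u) \<and> q_log_series p (Suc m) u = d * u"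
proof -
  let ?c = "\<lambda>k. real k ^ m / (real k * (1 - p ^ k))"
  have "((\<lambda>u. \<Sum>k. ?c k * u ^ k) has_real_derivative (\<Sum>k. diffs ?c k * u ^ k)) (at u)"
    using summable_q_log_series assms by (intro termdiffs_strong'[where K = 1]) auto
  moreover have "q_log_series p (Suc m) u = (\<Sum>k. diffs ?c k * u ^ k) * u"
    using summable_powser_index_mult(2)[OF summable_q_log_series assms, of m]
    by (simp add: q_log_series_def mult.assoc)
  ultimately show ?thesis
    unfolding q_log_series_def[abs_def] by blast
qed

lemma DERIV_q_log_series_powr:
  assumes "0 < x"
  shows "((\<lambda>x. q_log_series p m (p powr x)) has_real_derivative
           ln p * q_log_series p (Suc m) (p powr x)) (at x)"
proof -
  have "\<bar>p powr x\<bar> < 1" using assms base_powr_less_one by simp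
  then obtain d where "(q_log_series p m has_real_derivative d) (at (p powr x))"
    and d: "q_log_series p (Suc m) (p powr x) = d * p powr x"
    using DERIV_q_log_series by blast
  moreover have "((\<lambda>x. p powr x) has_real_derivative ln p * p powr x) (at x)"
    using p by (auto intro!: derivative_eq_intros)
  ultimately show ?thesis
    using DERIV_chain2[of "q_log_series p m" d "\<lambda>x. p powr x" x "ln p * p powr x" UNIV]
    by (simp add: d mult_ac)
qed

lemma q_log_series_pos:
  assumes "0 < u" "u < 1"
  shows "0 < q_log_series p m u"
  unfolding q_log_series_def
proof (rule suminf_pos2[of _ 1])
  show "summable (\<lambda>k. real k ^ m / (real k * (1 - p ^ k)) * u ^ k)"
    using assms by (intro summable_q_log_series) auto
  show "0 \<le> real k ^ m / (real k * (1 - p ^ k)) * u ^ k" for k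
    using assms p by (auto intro!: mult_nonneg_nonneg divide_nonneg_nonneg simp: power_le_one)
qed (use assms p in auto)

text \<open>
  In the difference the coefficients \<open>1 / (k (1 - p^k))\<close> are multiplied by \<open>1 - p^k\<close>, which leaves
  the series of the logarithm.
\<close>

lemma q_log_series_scale:
  assumes "0 < u" "u < 1"
  shows "q_log_series p 0 u - q_log_series p 0 (u * p) = - ln (1 - u)"
proof -
  have up: "\<bar>u * p\<bar> < 1"
    using assms p mult_strict_mono[of u 1 p 1] by auto
  have "q_log_series p 0 u - q_log_series p 0 (u * p)
      = (\<Sum>k. real k ^ 0 / (real k * (1 - p ^ k)) * u ^ k
            - real k ^ 0 / (real k * (1 - p ^ k)) * (u * p) ^ k)"
    unfolding q_log_series_def
    using assms up by (intro suminf_diff summable_q_log_series) auto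
  also have "(\<lambda>k. real k ^ 0 / (real k * (1 - p ^ k)) * u ^ k
            - real k ^ 0 / (real k * (1 - p ^ k)) * (u * p) ^ k) = (\<lambda>k. u ^ k / real k)"
  proof
    fix k
    show "real k ^ 0 / (real k * (1 - p ^ k)) * u ^ k
            - real k ^ 0 / (real k * (1 - p ^ k)) * (u * p) ^ k = u ^ k / real k"
    proof (cases "k = 0")
      case False
      have cancel: "1 / (K * A) * U - 1 / (K * A) * (U * (1 - A)) = U / K"
        if "K \<noteq> 0" "A \<noteq> 0" for K A U :: real
        using that by (simp add: field_simps)
      have "p ^ k < 1" using False p by (simp add: power_less_one_iff)
      with False show ?thesis
        using cancel[of "real k" "1 - p ^ k" "u ^ k"] by (simp add: power_mult_distrib)
    qed simp
  qed
  also have "(\<Sum>k. u ^ k / real k) = - ln (1 - u)"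
    using sums_minus[OF ln_series'[of "- u"]] assms by (simp add: sums_iff)
  finally show ?thesis .
qed

text \<open>
  By the previous lemma, \<open>ln (1 - p^(j + y))\<close> is a difference of consecutive values of the series
  at \<open>p^(j + y)\<close>, so the partial products telescope. The remainder vanishes by continuity of the
  series at \<open>0\<close>.
\<close>

lemma q_product_eq:
  assumes "0 < x"
  shows "(\<Prod>j. (1 - p powr (real j + 1)) / (1 - p powr (real j + x)))
       = exp (q_log_series p 0 (p powr x) - q_log_series p 0 p)"
proof -
  \<comment> \<open>the logarithm of the tail of the product from index \<open>j\<close> on\<close>
  define h where "h = (\<lambda>j. q_log_series p 0 (p powr x * p ^ j) - q_log_series p 0 (p * p ^ j))"
  have factor: "1 - p powr (real j + y)
      = exp (q_log_series p 0 (p powr y * p ^ Suc j) - q_log_series p 0 (p powr y * p ^ j))"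
    if "0 < y" for j y
  proof -
    have eq: "p powr (real j + y) = p powr y * p ^ j"
      using p by (simp add: powr_add powr_realpow)
    have less: "p powr y * p ^ j < 1"
      using base_powr_less_one[of "real j + y"] that by (simp add: eq)
    have "0 < p powr y * p ^ j" using p by simp
    have "1 - p powr y * p ^ j = exp (ln (1 - p powr y * p ^ j))"
      using less by simp
    also have "ln (1 - p powr y * p ^ j)
        = q_log_series p 0 (p powr y * p ^ Suc j) - q_log_series p 0 (p powr y * p ^ j)"
      using q_log_series_scale[OF \<open>0 < p powr y * p ^ j\<close> less] by (simp add: mult_ac)
    finally show ?thesis unfolding eq .
  qed
  have ratio: "(1 - p powr (real j + 1)) / (1 - p powr (real j + x)) = exp (h j - h (Suc j))" for j
    using factor[of 1 j] factor[OF assms, of j] p by (simp add: h_def flip: exp_diff)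
  have partial: "(\<Prod>j\<le>n. (1 - p powr (real j + 1)) / (1 - p powr (real j + x)))
      = exp (h 0 - h (Suc n))" for n
    unfolding ratio by (simp add: exp_sum[symmetric] sum_telescope)
  have cont: "isCont (q_log_series p 0) 0"
    using DERIV_q_log_series[of 0 0] by (auto intro: DERIV_isCont)
  have "(\<lambda>n. q_log_series p 0 (c * p ^ Suc n)) \<longlonglongrightarrow> q_log_series p 0 0" for c
  proof (rule isCont_tendsto_compose[OF cont])
    show "(\<lambda>n. c * p ^ Suc n) \<longlonglongrightarrow> 0"
      using p by (intro tendsto_mult_right_zero LIMSEQ_Suc LIMSEQ_power_zero) auto
  qed
  from tendsto_diff[OF this[of "p powr x"] this[of p]] have "(\<lambda>n. h (Suc n)) \<longlonglongrightarrow> 0"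
    by (simp add: h_def)
  then have "(\<lambda>n. exp (h 0 - h (Suc n))) \<longlonglongrightarrow> exp (h 0 - 0)"
    by (intro tendsto_intros)
  then have "(\<lambda>j. (1 - p powr (real j + 1)) / (1 - p powr (real j + x))) has_prod exp (h 0)"
    by (simp add: has_prod_def raw_has_prod_def partial)
  then show ?thesis
    by (simp add: has_prod_unique[symmetric] h_def)
qed

text \<open>
  The polynomial exponent is written so that it vanishes at \<open>1\<close>. The relation between \<open>b\<close> and
  \<open>c\<close> expresses that \<open>f 2 = 1\<close>: at \<open>2\<close> the exponent is \<open>c - b\<close> and the product telescopes to
  \<open>1 - p\<close>.
\<close>

lemma monotonicity_and_product_bound_q_product:
  fixes f :: "real \<Rightarrow> real" and b c :: real
  assumes f: "\<And>x. 0 < x \<Longrightarrow> f x = exp ((1 - x) * b + c * (x * (x - 1) / 2)) *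
        (\<Prod>j. (1 - p powr (real j + 1)) / (1 - p powr (real j + x)))"
    and "0 \<le> c" and bc: "b = ln (1 - p) + c"
  shows "log_completely_monotonic_on f {0<..<THE x. 0 < x \<and> deriv f x / f x = 0}"
    and "\<And>x y. x \<in> {0<..<1} \<Longrightarrow> y \<in> {0<..<1} \<Longrightarrow> f (x + 1) * f (y + 1) \<le> f (x + y + 2)"
proof -
  \<comment> \<open>the derivatives of the quadratic polynomial that \<open>ln f\<close> contains besides the series\<close>
  define Q where "Q = (\<lambda>(n::nat) x. if n = 0 then (1 - x) * b + c * (x * (x - 1) / 2) - q_log_series p 0 p
    else if n = 1 then c * (x - 1 / 2) - b else if n = 2 then c else (0::real))"
  define D where "D = (\<lambda>n x. Q n x + ln p ^ n * q_log_series p n (p powr x))"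
  have deriv_Q: "(Q n has_real_derivative Q (Suc n) x) (at x)" for n x
  proof -
    consider "n = 0" | "n = 1" | "n = 2" | "2 < n" by linarith
    then show ?thesis
      by cases (auto simp: Q_def field_simps intro!: derivative_eq_intros)
  qed
  have f_D: "f x = exp (D 0 x)" if "0 < x" for x
    using that by (simp add: f q_product_eq D_def Q_def flip: exp_add)
  have f2: "D 0 2 = 0"
    using q_log_series_scale[of p] p bc by (simp add: D_def Q_def power2_eq_square)
  have deriv_D: "(D n has_real_derivative D (Suc n) x) (at x)" if "0 < x" for n x
    unfolding D_def using DERIV_q_log_series_powr[OF that, of n]
    by (auto intro!: derivative_eq_intros deriv_Q simp: mult_ac)
  have sign: "0 < (- 1) ^ n * D n x" if "2 \<le> n" "0 < x" for n x
  proof -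
    have "0 \<le> (- 1) ^ n * Q n x"
      using that \<open>0 \<le> c\<close> by (auto simp: Q_def)
    moreover have "0 < (- ln p) ^ n * q_log_series p n (p powr x)"
      using p that base_powr_less_one by (intro mult_pos_pos zero_less_power q_log_series_pos) auto
    ultimately show ?thesis
      by (simp add: D_def algebra_simps power_minus[of "ln p" n])
  qed
  have f1: "D 0 1 = 0"
    using p by (simp add: D_def Q_def)
  note core = monotonicity_and_product_bound_from_derivatives[where f = f and D = D, OF _ _ deriv_D sign]
  show "log_completely_monotonic_on f {0<..<THE x. 0 < x \<and> deriv f x / f x = 0}"
    by (rule core(1)) (auto simp: f_D f1 f2)
  show "f (x + 1) * f (y + 1) \<le> f (x + y + 2)" if "x \<in> {0<..<1}" "y \<in> {0<..<1}" for x y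
    using that by (intro core(2)) (auto simp: f_D f1 f2)
qed

end

section \<open>The three ranges of the base\<close>

lemma monotonicity_and_product_bound_Gamma:
  shows "log_completely_monotonic_on Gamma {0<..<THE x::real. 0 < x \<and> deriv Gamma x / Gamma x = 0}"
    and "\<And>x y :: real. x \<in> {0<..<1} \<Longrightarrow> y \<in> {0<..<1} \<Longrightarrow>
           Gamma (x + 1) * Gamma (y + 1) \<le> Gamma (x + y + 2)"
proof -
  define D :: "nat \<Rightarrow> real \<Rightarrow> real"
    where "D = (\<lambda>n. case n of 0 \<Rightarrow> ln_Gamma | Suc m \<Rightarrow> Polygamma m)"
  have deriv_D: "(D n has_real_derivative D (Suc n) x) (at x)" if "0 < x" for n x
    using that by (cases n) (auto simp: D_def intro!: has_field_derivative_ln_Gamma_real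
        has_field_derivative_Polygamma elim!: nonpos_Ints_cases)
  have sign: "0 < (- 1) ^ n * D n x" if n: "2 \<le> n" and x: "0 < x" for n x
  proof -
    obtain m where m: "n = Suc m" "0 < m" using n by (cases n) auto
    have "x \<notin> \<int>\<^sub>\<le>\<^sub>0" using x by (auto elim!: nonpos_Ints_cases)
    then show ?thesis
      using Polygamma_real_odd_pos[of x m] Polygamma_real_even_neg[OF x, of m] m
      by (cases "even m") (auto simp: D_def)
  qed
  note core = monotonicity_and_product_bound_from_derivatives[where f = Gamma and D = D, OF _ _ deriv_D sign]
  show "log_completely_monotonic_on Gamma {0<..<THE x::real. 0 < x \<and> deriv Gamma x / Gamma x = 0}"
    by (rule core(1)) (auto simp: D_def ln_Gamma_real_pos Gamma_numeral)
  show "Gamma (x + 1) * Gamma (y + 1) \<le> Gamma (x + y + 2)"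
    if "x \<in> {0<..<1}" "y \<in> {0<..<1}" for x y :: real
    using that by (intro core(2)) (auto simp: D_def ln_Gamma_real_pos Gamma_numeral)
qed

theorem theorem4:
  fixes q :: real
  assumes "0 < q"
  shows "log_completely_monotonic_on (q_Gamma q) {0<..<q_Digamma_zero q} \<and>
         (\<forall>x\<in>{0<..<1}. \<forall>y\<in>{0<..<1}.
            q_Gamma q (x + 1) * q_Gamma q (y + 1) \<le> q_Gamma q (x + y + 2))"
proof -
  consider "q < 1" | "q = 1" | "1 < q" by linarith
  then show ?thesis
  proof cases
    case 1
    have "q_Gamma q x = exp ((1 - x) * ln (1 - q) + 0 * (x * (x - 1) / 2)) *
        (\<Prod>j. (1 - q powr (real j + 1)) / (1 - q powr (real j + x)))" for x
      using 1 by (simp add: q_Gamma_def powr_def)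
    from monotonicity_and_product_bound_q_product[OF assms 1 this] show ?thesis
      by (simp add: q_Digamma_zero_def q_Digamma_def)
  next
    case 2
    then have "q_Gamma q = Gamma" by (simp add: q_Gamma_def fun_eq_iff)
    with monotonicity_and_product_bound_Gamma show ?thesis
      by (simp add: q_Digamma_zero_def q_Digamma_def)
  next
    case 3
    \<comment> \<open>the product of this branch is the one in the base \<open>1 / q\<close>\<close>
    have powr: "q powr (- y) = (1 / q) powr y" for y
      using 3 by (simp add: powr_minus_divide powr_divide)
    have "q_Gamma q x = exp ((1 - x) * ln (q - 1) + ln q * (x * (x - 1) / 2)) *
        (\<Prod>j. (1 - (1 / q) powr (real j + 1)) / (1 - (1 / q) powr (real j + x)))" for x
      using 3 unfolding powr[symmetric] by (simp add: q_Gamma_def powr_def exp_add mult_ac)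
    moreover have "ln (q - 1) = ln (1 - 1 / q) + ln q"
    proof -
      have "1 - 1 / q = (q - 1) / q" using 3 by (simp add: field_simps)
      then show ?thesis using 3 by (simp add: ln_div)
    qed
    ultimately show ?thesis
      using monotonicity_and_product_bound_q_product[of "1 / q" "q_Gamma q" "ln (q - 1)" "ln q"] 3
      by (simp add: q_Digamma_zero_def q_Digamma_def)
  qed
qed

end
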